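(* Let $\mathbb{F}$ be a field of characteristic $2$ with at least $4$ elements, let $k\geq 1$ be an integer, and let $B\in M_{4k+1}(\mathbb{F})$ be a non-derogative matrix with $\operatorname{Trace}(B)=c$. Then for every $a\in\mathbb{F}$ with $a\neq 0,1$, there exist $N,D\in M_{4k+1}(\mathbb{F})$ with $B=N+D$, $N^2=0$, and $D$ diagonalizable with every eigenvalue in $\{c,\ c+1,\ c+a,\ c+a+1\}$.
   Context: A square matrix is non-derogative if its minimal polynomial equals its characteristic polynomial. A matrix $D\in M_n(\mathbb{F})$ is diagonalizable if there exists an invertible $U\in M_n(\mathbb{F})$ such that $U^{-1}DU$ is diagonal. *)

theory Defs
  imports "Jordan_Normal_Form.Char_Poly"
begin

definition mat_trace :: "'a :: comm_ring_1 mat \<Rightarrow> 'a" where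
  "mat_trace A = (\<Sum>i<dim_row A. A $$ (i, i))"

definition poly_mat :: "'a :: comm_ring_1 poly \<Rightarrow> 'a mat \<Rightarrow> 'a mat" where
  "poly_mat p A = foldr (\<lambda>i M. coeff p i \<cdot>\<^sub>m (A ^\<^sub>m i) + M) [0..<Suc (degree p)]
                     (0\<^sub>m (dim_row A) (dim_row A))"

definition is_minimal_poly :: "'a :: field mat \<Rightarrow> 'a poly \<Rightarrow> bool" where
  "is_minimal_poly A p \<longleftrightarrow>
     monic p \<and> poly_mat p A = 0\<^sub>m (dim_row A) (dim_row A) \<and>
     (\<forall>q. q \<noteq> 0 \<and> poly_mat q A = 0\<^sub>m (dim_row A) (dim_row A) \<longrightarrow> degree p \<le> degree q)"

definition minimal_poly :: "'a :: field mat \<Rightarrow> 'a poly" where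
  "minimal_poly A = (THE p. is_minimal_poly A p)"

definition non_derogative :: "'a :: field mat \<Rightarrow> bool" where
  "non_derogative A \<longleftrightarrow> minimal_poly A = char_poly A"

definition diagonalizable :: "'a :: field mat \<Rightarrow> bool" where
  "diagonalizable D \<longleftrightarrow> (\<exists>U V. U \<in> carrier_mat (dim_row D) (dim_row D) \<and>
       V \<in> carrier_mat (dim_row D) (dim_row D) \<and>
       U * V = 1\<^sub>m (dim_row D) \<and> V * U = 1\<^sub>m (dim_row D) \<and>
       diagonal_mat (V * D * U))"

end

(* A non-derogative B has a cyclic vector: by unique factorisation in F[X], the annihilator of a
   vector whose annihilator has maximal degree annihilates B, so that degree is n = 4k + 1.
   In the Newton basis w_j = (B - mu_0) ... (B - mu_(j-1)) v of a cyclic vector v, with shifts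
   mu_j = c + a for even j and mu_j = c + a + 1 for odd j, B becomes lower Hessenberg with diagonal
   mu_0, ..., mu_(4k-1), ones below the diagonal and an arbitrary last column. The 4k shifts sum to 0
   in characteristic 2, so the trace forces the last diagonal entry to be c. Deleting the subdiagonal
   ones in the odd columns leaves a square-zero N, and D = B - N is diagonalizable: w_j (j odd) and
   w_j + w_(j+1) (j even) are eigenvectors for c + a + 1 and c + a, and
   (D - c - a)(D - c - a - 1) w_(4k) is an eigenvector for c completing them to a basis, since its
   last coordinate a (a + 1) is nonzero. *)

theory Submission
  imports Defs "HOL-Computational_Algebra.Polynomial_Factorial"
begin

lemma mult_mat_vec_zero_vec [simp]:
  "A \<in> carrier_mat m n \<Longrightarrow> A *\<^sub>v 0\<^sub>v n = 0\<^sub>v m"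
  by (rule eq_vecI) (auto simp: scalar_prod_def)

lemma mult_mat_vec_unit_vec:
  assumes A: "(A :: 'a :: semiring_1 mat) \<in> carrier_mat m n" and j: "j < n"
  shows "A *\<^sub>v unit_vec n j = col A j"
proof (rule eq_vecI)
  fix i assume "i < dim_vec (col A j)"
  with A have i: "i < m" by simp
  have "(A *\<^sub>v unit_vec n j) $ i = (\<Sum>l<n. A $$ (i, l) * (if l = j then 1 else 0))"
    using A i j by (simp add: scalar_prod_def atLeast0LessThan)
  also have "\<dots> = (\<Sum>l<n. if l = j then A $$ (i, l) else 0)"
    by (rule sum.cong) auto
  finally show "(A *\<^sub>v unit_vec n j) $ i = col A j $ i" using A i j by simp
qed (use A in simp)

lemma mat_eq_zero_if_unit_vecs:
  assumes A: "(A :: 'a :: semiring_1 mat) \<in> carrier_mat m n" and zero: "\<And>j. j < n \<Longrightarrow> A *\<^sub>v unit_vec n j = 0\<^sub>v m"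
  shows "A = 0\<^sub>m m n"
proof (rule eq_matI)
  fix i j assume "i < dim_row (0\<^sub>m m n :: 'a mat)" "j < dim_col (0\<^sub>m m n :: 'a mat)"
  then have ij: "i < m" "j < n" by auto
  have "A $$ (i, j) = (A *\<^sub>v unit_vec n j) $ i"
    using A ij by (simp add: mult_mat_vec_unit_vec)
  with zero ij show "A $$ (i, j) = 0\<^sub>m m n $$ (i, j)" by simp
qed (use A in auto)

lemma minus_smult_one_mult_vec:
  assumes A: "(A :: 'a :: comm_ring_1 mat) \<in> carrier_mat n n" and x: "x \<in> carrier_vec n"
  shows "(A - s \<cdot>\<^sub>m 1\<^sub>m n) *\<^sub>v x = A *\<^sub>v x - s \<cdot>\<^sub>v x"
proof -
  have "(s \<cdot>\<^sub>m 1\<^sub>m n) *\<^sub>v x = s \<cdot>\<^sub>v x"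
  proof (rule eq_vecI)
    fix i assume "i < dim_vec (s \<cdot>\<^sub>v x)"
    with x have i: "i < n" by simp
    have "((s \<cdot>\<^sub>m 1\<^sub>m n) *\<^sub>v x) $ i = (\<Sum>l<n. s * (if l = i then 1 else 0) * x $ l)"
      using x i by (simp add: scalar_prod_def atLeast0LessThan)
    also have "\<dots> = (\<Sum>l<n. if l = i then s * x $ l else 0)"
      by (rule sum.cong) auto
    finally show "((s \<cdot>\<^sub>m 1\<^sub>m n) *\<^sub>v x) $ i = (s \<cdot>\<^sub>v x) $ i" using i x by simp
  qed (use x in simp)
  then show ?thesis
    using A x by (simp add: minus_mult_distrib_mat_vec[of _ n n])
qed

lemma inverse_mat_if_det_nonzero:
  assumes A: "(A :: 'a :: field mat) \<in> carrier_mat n n" and det: "det A \<noteq> 0"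
  obtains B where "B \<in> carrier_mat n n" "A * B = 1\<^sub>m n" "B * A = 1\<^sub>m n"
  using det_non_zero_imp_unit[OF A det] that by (auto simp: Units_def ring_mat_def)

section \<open>Polynomials evaluated at a matrix\<close>

lemma pow_mat_Suc_left:
  assumes A: "A \<in> carrier_mat n n"
  shows "A ^\<^sub>m Suc l = A * A ^\<^sub>m l"
proof (induct l)
  case (Suc l)
  have "A ^\<^sub>m Suc (Suc l) = (A * A ^\<^sub>m l) * A" using Suc by simp
  also have "\<dots> = A * (A ^\<^sub>m l * A)" using A by (simp add: assoc_mult_mat[of _ n n _ n _ n])
  finally show ?case by simp
qed (use A in simp)

lemma poly_mat_foldr:
  assumes A: "A \<in> carrier_mat n n"
  shows "foldr (\<lambda>i M. coeff p i \<cdot>\<^sub>m (A ^\<^sub>m i) + M) xs (0\<^sub>m n n) \<in> carrier_mat n n \<and>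
    (\<forall>i j. i < n \<longrightarrow> j < n \<longrightarrow> foldr (\<lambda>i M. coeff p i \<cdot>\<^sub>m (A ^\<^sub>m i) + M) xs (0\<^sub>m n n) $$ (i, j)
       = (\<Sum>l\<leftarrow>xs. coeff p l * (A ^\<^sub>m l) $$ (i, j)))"
  by (induct xs) (auto simp: A carrier_matD[OF A])

lemma poly_mat_carrier [simp]:
  assumes A: "A \<in> carrier_mat n n"
  shows "poly_mat p A \<in> carrier_mat n n"
  using conjunct1[OF poly_mat_foldr[OF A]] A unfolding poly_mat_def by (simp del: upt_Suc)

lemma poly_mat_dim [simp]:
  assumes A: "A \<in> carrier_mat n n"
  shows "dim_row (poly_mat p A) = n" "dim_col (poly_mat p A) = n"
  using poly_mat_carrier[OF A] by auto

lemma poly_mat_index: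
  assumes A: "A \<in> carrier_mat n n" and ij: "i < n" "j < n" and K: "degree p < K"
  shows "poly_mat p A $$ (i, j) = (\<Sum>l<K. coeff p l * (A ^\<^sub>m l) $$ (i, j))"
proof -
  have "poly_mat p A $$ (i, j) = (\<Sum>l\<leftarrow>[0..<Suc (degree p)]. coeff p l * (A ^\<^sub>m l) $$ (i, j))"
    using poly_mat_foldr[OF A, of p "[0..<Suc (degree p)]"] A ij
    unfolding poly_mat_def by (simp del: upt_Suc)
  also have "\<dots> = (\<Sum>l<Suc (degree p). coeff p l * (A ^\<^sub>m l) $$ (i, j))"
    by (simp only: sum_set_upt_conv_sum_list_nat[symmetric] set_upt atLeast0LessThan)
  also have "\<dots> = (\<Sum>l<K. coeff p l * (A ^\<^sub>m l) $$ (i, j))"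
    by (rule sum.mono_neutral_left) (use K in \<open>auto simp: coeff_eq_0\<close>)
  finally show ?thesis .
qed

lemma poly_mat_add:
  assumes A: "A \<in> carrier_mat n n"
  shows "poly_mat (p + q) A = poly_mat p A + poly_mat q A"
proof (rule eq_matI)
  let ?K = "Suc (max (degree p) (degree q))"
  fix i j assume "i < dim_row (poly_mat p A + poly_mat q A)" "j < dim_col (poly_mat p A + poly_mat q A)"
  then have ij: "i < n" "j < n" using A by auto
  have "degree (p + q) < ?K" using degree_add_le_max[of p q] by simp
  then show "poly_mat (p + q) A $$ (i, j) = (poly_mat p A + poly_mat q A) $$ (i, j)"
    using A ij by (simp add: poly_mat_index[OF A ij] poly_mat_index[OF A ij, of p ?K]
        poly_mat_index[OF A ij, of q ?K] sum.distrib distrib_right)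
qed (use A in auto)

lemma poly_mat_diff:
  assumes A: "A \<in> carrier_mat n n"
  shows "poly_mat (p - q) A = poly_mat p A - poly_mat q A"
proof (rule eq_matI)
  let ?K = "Suc (max (degree p) (degree q))"
  fix i j assume "i < dim_row (poly_mat p A - poly_mat q A)" "j < dim_col (poly_mat p A - poly_mat q A)"
  then have ij: "i < n" "j < n" using A by auto
  have "degree (p - q) < ?K" using degree_diff_le_max[of p q] by simp
  then show "poly_mat (p - q) A $$ (i, j) = (poly_mat p A - poly_mat q A) $$ (i, j)"
    using A ij by (simp add: poly_mat_index[OF A ij] poly_mat_index[OF A ij, of p ?K]
        poly_mat_index[OF A ij, of q ?K] sum_subtractf left_diff_distrib)
qed (use A in auto)

lemma poly_mat_smult:
  assumes A: "A \<in> carrier_mat n n"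
  shows "poly_mat (Polynomial.smult c p) A = c \<cdot>\<^sub>m poly_mat p A"
proof (rule eq_matI)
  let ?K = "Suc (degree p)"
  fix i j assume "i < dim_row (c \<cdot>\<^sub>m poly_mat p A)" "j < dim_col (c \<cdot>\<^sub>m poly_mat p A)"
  then have ij: "i < n" "j < n" using A by auto
  have "degree (Polynomial.smult c p) < ?K" using degree_smult_le[of c p] by simp
  then show "poly_mat (Polynomial.smult c p) A $$ (i, j) = (c \<cdot>\<^sub>m poly_mat p A) $$ (i, j)"
    using A ij by (simp add: poly_mat_index[OF A ij] poly_mat_index[OF A ij, of p ?K]
        sum_distrib_left mult.assoc distrib_left)
qed (use A in auto)

lemma poly_mat_const:
  assumes A: "A \<in> carrier_mat n n"
  shows "poly_mat [:c:] A = c \<cdot>\<^sub>m 1\<^sub>m n"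
  by (rule eq_matI) (use A in \<open>auto simp: poly_mat_index[OF A, of _ _ _ 1]\<close>)

lemma poly_mat_0:
  assumes A: "A \<in> carrier_mat n n"
  shows "poly_mat 0 A = 0\<^sub>m n n"
  by (rule eq_matI) (use A in \<open>auto simp: poly_mat_index[OF A, of _ _ _ 1]\<close>)

lemma poly_mat_X:
  assumes A: "A \<in> carrier_mat n n"
  shows "poly_mat [:0, 1:] A = A"
  by (rule eq_matI) (use A in \<open>auto simp: poly_mat_index[OF A, of _ _ _ 2] numeral_2_eq_2\<close>)

lemma poly_mat_pCons_0:
  assumes A: "A \<in> carrier_mat n n"
  shows "poly_mat (pCons 0 p) A = A * poly_mat p A"
proof (rule eq_matI)
  let ?K = "Suc (degree p)"
  fix i j assume "i < dim_row (A * poly_mat p A)" "j < dim_col (A * poly_mat p A)"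
  then have ij: "i < n" "j < n" using A by auto
  have d: "degree (pCons 0 p) < Suc ?K" by (cases "p = 0") auto
  have "poly_mat (pCons 0 p) A $$ (i, j) = (\<Sum>l<Suc ?K. coeff (pCons 0 p) l * (A ^\<^sub>m l) $$ (i, j))"
    by (rule poly_mat_index[OF A ij d])
  also have "\<dots> = (\<Sum>l<?K. coeff p l * (A ^\<^sub>m Suc l) $$ (i, j))"
    by (subst sum.lessThan_Suc_shift) simp
  also have "\<dots> = (\<Sum>l<?K. coeff p l * (\<Sum>m<n. A $$ (i, m) * (A ^\<^sub>m l) $$ (m, j)))"
    using A ij by (auto simp: pow_mat_Suc_left[OF A] scalar_prod_def atLeast0LessThan
        simp del: pow_mat.simps intro!: sum.cong)
  also have "\<dots> = (\<Sum>m<n. A $$ (i, m) * (\<Sum>l<?K. coeff p l * (A ^\<^sub>m l) $$ (m, j)))"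
    by (simp add: sum_distrib_left sum_distrib_right sum.swap[of _ "{..<n}"] mult_ac
        del: sum.lessThan_Suc)
  also have "\<dots> = (A * poly_mat p A) $$ (i, j)"
    using A ij by (auto simp: scalar_prod_def atLeast0LessThan poly_mat_index[OF A _ ij(2), of _ p ?K]
        intro!: sum.cong)
  finally show "poly_mat (pCons 0 p) A $$ (i, j) = (A * poly_mat p A) $$ (i, j)" .
qed (use A in auto)

lemma poly_mat_mult:
  assumes A: "A \<in> carrier_mat n n"
  shows "poly_mat (p * q) A = poly_mat p A * poly_mat q A"
proof (induct p rule: pCons_induct)
  case 0
  then show ?case using A by (simp add: poly_mat_0)
next
  case (pCons a p)
  have P: "poly_mat p A \<in> carrier_mat n n" "poly_mat q A \<in> carrier_mat n n" using A by auto
  have "poly_mat (pCons a p * q) A = poly_mat (Polynomial.smult a q + pCons 0 (p * q)) A"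
    by simp
  also have "\<dots> = a \<cdot>\<^sub>m poly_mat q A + A * (poly_mat p A * poly_mat q A)"
    using A pCons(2) by (simp add: poly_mat_add poly_mat_smult poly_mat_pCons_0)
  also have "\<dots> = (a \<cdot>\<^sub>m 1\<^sub>m n) * poly_mat q A + (A * poly_mat p A) * poly_mat q A"
    using A P by (simp add: mult_smult_assoc_mat[of "1\<^sub>m n" n n _ n] assoc_mult_mat[of _ n n _ n _ n])
  also have "\<dots> = (a \<cdot>\<^sub>m 1\<^sub>m n + A * poly_mat p A) * poly_mat q A"
    by (rule add_mult_distrib_mat[of _ n n, symmetric]) (use A P in auto)
  also have "a \<cdot>\<^sub>m 1\<^sub>m n + A * poly_mat p A = poly_mat (pCons a p) A"
    using poly_mat_add[OF A, of "[:a:]" "pCons 0 p"]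
    by (simp add: poly_mat_const[OF A] poly_mat_pCons_0[OF A])
  finally show ?case .
qed

lemma poly_mat_linear:
  assumes A: "A \<in> carrier_mat n n"
  shows "poly_mat [:- x, 1:] A = A - x \<cdot>\<^sub>m 1\<^sub>m n"
  using poly_mat_diff[OF A, of "[:0, 1:]" "[:x:]"] by (simp add: poly_mat_X[OF A] poly_mat_const[OF A])

lemma poly_mat_mult_vec_index:
  assumes A: "A \<in> carrier_mat n n" and v: "v \<in> carrier_vec n" and i: "i < n" and K: "degree p < K"
  shows "(poly_mat p A *\<^sub>v v) $ i = (\<Sum>l<K. coeff p l * (A ^\<^sub>m l *\<^sub>v v) $ i)"
proof -
  have "(poly_mat p A *\<^sub>v v) $ i = (\<Sum>m<n. (\<Sum>l<K. coeff p l * (A ^\<^sub>m l) $$ (i, m)) * v $ m)"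
    using A v i by (auto simp: scalar_prod_def atLeast0LessThan poly_mat_index[OF A i _ K] intro!: sum.cong)
  also have "\<dots> = (\<Sum>l<K. coeff p l * (\<Sum>m<n. (A ^\<^sub>m l) $$ (i, m) * v $ m))"
    by (simp add: sum_distrib_left sum_distrib_right sum.swap[of _ "{..<n}"] mult_ac)
  also have "\<dots> = (\<Sum>l<K. coeff p l * (A ^\<^sub>m l *\<^sub>v v) $ i)"
    using A v i by (auto simp: scalar_prod_def atLeast0LessThan intro!: sum.cong)
  finally show ?thesis .
qed

lemma poly_mat_mult_vec_carrier [simp]:
  "A \<in> carrier_mat n n \<Longrightarrow> v \<in> carrier_vec n \<Longrightarrow> poly_mat p A *\<^sub>v v \<in> carrier_vec n"
  by (metis mult_mat_vec_carrier poly_mat_carrier)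

section \<open>Annihilators and cyclic vectors\<close>

(* Polynomial_Factorial proves unique factorisation in 'a poly for an arbitrary field 'a only
   through an interpretation local to an anonymous context, since a field is not an instance of
   factorial_ring_gcd; we repeat that interpretation to reason with multiplicities of primes. *)
interpretation field_poly:
  normalization_euclidean_semiring where zero = "0 :: 'a :: field poly"
    and one = 1 and plus = plus and minus = minus and times = times
    and normalize = "\<lambda>p. Polynomial.smult (inverse (lead_coeff p)) p"
    and unit_factor = "\<lambda>p. [:lead_coeff p:]"
    and euclidean_size = "\<lambda>p. if p = 0 then 0 else 2 ^ degree p"
    and divide = divide and modulo = modulo
  rewrites "dvd.dvd (times :: 'a poly \<Rightarrow> _) = Rings.dvd"
    and "comm_semiring_1.prime_elem times 1 0 = prime_elem"
    and "power.power (1 :: 'a poly) times = (^)"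
proof -
  show "dvd.dvd (times :: 'a poly \<Rightarrow> _) = Rings.dvd"
    by (simp add: dvd_dict)
  show "comm_semiring_1.prime_elem times 1 0 = prime_elem"
    by (simp add: prime_elem_dict)
  show "power.power (1 :: 'a poly) times = (^)"
    by (simp add: power_dict)
  show "class.normalization_euclidean_semiring divide plus minus (0 :: 'a poly) times 1
    modulo (\<lambda>p. if p = 0 then 0 else 2 ^ degree p)
    (\<lambda>p. [:lead_coeff p:]) (\<lambda>p. Polynomial.smult (inverse (lead_coeff p)) p)"
  proof (standard, fold dvd_dict)
    fix p :: "'a poly"
    show "[:lead_coeff p:] * Polynomial.smult (inverse (lead_coeff p)) p = p"
      by (cases "p = 0") simp_all
  next
    fix p :: "'a poly" assume "is_unit p"
    then show "[:lead_coeff p:] = p"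
      by (auto simp: degree_0_id elim!: is_unit_polyE)
  next
    fix p q :: "'a poly" assume "is_unit p"
    then obtain c where "p = [:c:]" by (rule is_unit_polyE)
    then show "[:lead_coeff (p * q):] = p * [:lead_coeff q:]"
      by (simp add: lead_coeff_mult)
  qed (auto simp: is_unit_pCons_iff lead_coeff_mult Rings.div_mult_mod_eq
      intro!: degree_mod_less' degree_mult_right_le)
qed

definition annihilates :: "'a :: field mat \<Rightarrow> 'a poly \<Rightarrow> 'a vec \<Rightarrow> bool" where
  "annihilates A q v \<longleftrightarrow> poly_mat q A *\<^sub>v v = 0\<^sub>v (dim_row A)"

definition generates_annihilator :: "'a :: field mat \<Rightarrow> 'a vec \<Rightarrow> 'a poly \<Rightarrow> bool" where
  "generates_annihilator A v g \<longleftrightarrow> g \<noteq> 0 \<and> (\<forall>q. annihilates A q v \<longleftrightarrow> g dvd q)"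

lemma annihilates_mult:
  assumes A: "A \<in> carrier_mat n n" and v: "v \<in> carrier_vec n" and q: "annihilates A q v"
  shows "annihilates A (p * q) v"
proof -
  have "poly_mat (p * q) A *\<^sub>v v = poly_mat p A *\<^sub>v (poly_mat q A *\<^sub>v v)"
    using A v by (simp add: poly_mat_mult[OF A] assoc_mult_mat_vec[of _ n n _ n])
  with q A show ?thesis unfolding annihilates_def by simp
qed

lemma annihilates_diff:
  assumes A: "A \<in> carrier_mat n n" and v: "v \<in> carrier_vec n"
    and "annihilates A p v" "annihilates A q v"
  shows "annihilates A (p - q) v"
  using assms unfolding annihilates_def by (simp add: poly_mat_diff[OF A] minus_mult_distrib_mat_vec[of _ n n])

lemma annihilates_poly_mat_mult_vec:
  assumes A: "A \<in> carrier_mat n n" and v: "v \<in> carrier_vec n"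
  shows "annihilates A q (poly_mat p A *\<^sub>v v) \<longleftrightarrow> annihilates A (q * p) v"
  using A v by (simp add: annihilates_def poly_mat_mult[OF A] assoc_mult_mat_vec[of _ n n _ n])

lemma annihilates_add_vec:
  assumes A: "A \<in> carrier_mat n n" and v: "v \<in> carrier_vec n" and w: "w \<in> carrier_vec n"
    and q: "annihilates A q v"
  shows "annihilates A q (v + w) \<longleftrightarrow> annihilates A q w"
  using q A v w unfolding annihilates_def by (simp add: mult_add_distrib_mat_vec[of _ n n])

(* The n + 1 vectors A^j v, j \<le> n, are the columns of a square matrix whose last row is zero. *)
lemma annihilator_exists:
  assumes A: "A \<in> carrier_mat n n" and v: "v \<in> carrier_vec n"
  shows "\<exists>q. q \<noteq> 0 \<and> degree q \<le> n \<and> annihilates A q v"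
proof -
  define K where "K = mat (Suc n) (Suc n) (\<lambda>(i, j). if i < n then (A ^\<^sub>m j *\<^sub>v v) $ i else 0)"
  have K: "K \<in> carrier_mat (Suc n) (Suc n)" unfolding K_def by auto
  have "det K = (\<Sum>j<Suc n. K $$ (n, j) * cofactor K n j)"
    by (rule laplace_expansion_row[OF K]) simp
  also have "\<dots> = 0" unfolding K_def by simp
  finally obtain x where x: "x \<in> carrier_vec (Suc n)" "x \<noteq> 0\<^sub>v (Suc n)" "K *\<^sub>v x = 0\<^sub>v (Suc n)"
    using det_0_iff_vec_prod_zero_field[OF K] by auto
  define q where "q = (\<Sum>j<Suc n. monom (x $ j) j)"
  have coeff_q: "coeff q l = (if l < Suc n then x $ l else 0)" for l
    unfolding q_def coeff_sum by (auto simp: coeff_monom)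
  have deg: "degree q \<le> n" by (rule degree_le) (auto simp: coeff_q)
  have "q \<noteq> 0"
  proof
    assume "q = 0"
    then have "x $ l = 0" if "l < Suc n" for l using coeff_q[of l] that by simp
    then have "x = 0\<^sub>v (Suc n)" using x(1) by (intro eq_vecI) auto
    with x(2) show False by simp
  qed
  moreover have "annihilates A q v"
    unfolding annihilates_def
  proof (rule eq_vecI)
    fix i assume "i < dim_vec (0\<^sub>v (dim_row A) :: 'a vec)"
    with A have i: "i < n" by simp
    have "(poly_mat q A *\<^sub>v v) $ i = (\<Sum>l<Suc n. coeff q l * (A ^\<^sub>m l *\<^sub>v v) $ i)"
      by (rule poly_mat_mult_vec_index[OF A v i]) (use deg in auto)
    also have "\<dots> = (K *\<^sub>v x) $ i"
      using i x(1) unfolding K_def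
      by (auto simp: scalar_prod_def coeff_q atLeast0LessThan mult.commute intro!: sum.cong)
    finally show "(poly_mat q A *\<^sub>v v) $ i = 0\<^sub>v (dim_row A) $ i" using x(3) i A by simp
  qed (use A in auto)
  ultimately show ?thesis using deg by blast
qed

lemma generates_annihilator_exists:
  assumes A: "A \<in> carrier_mat n n" and v: "v \<in> carrier_vec n"
  obtains g where "generates_annihilator A v g"
proof -
  define P where "P = (\<lambda>d. \<exists>q. q \<noteq> 0 \<and> annihilates A q v \<and> degree q = d)"
  from annihilator_exists[OF A v] have "\<exists>d. P d" unfolding P_def by blast
  then have "P (Least P)" by (rule LeastI_ex)
  then obtain g where g: "g \<noteq> 0" "annihilates A g v" "degree g = Least P" unfolding P_def by auto
  have "annihilates A q v \<longleftrightarrow> g dvd q" for q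
  proof
    assume q: "annihilates A q v"
    have "annihilates A (q - (q div g) * g) v"
      by (rule annihilates_diff[OF A v q annihilates_mult[OF A v g(2)]])
    then have r: "annihilates A (q mod g) v" by (simp add: minus_div_mult_eq_mod)
    show "g dvd q"
    proof (rule ccontr)
      assume "\<not> g dvd q"
      then have "q mod g \<noteq> 0" "degree (q mod g) < degree g"
        using degree_mod_less_degree[OF g(1)] by (auto simp: mod_eq_0_iff_dvd)
      with r have "P (degree (q mod g))" unfolding P_def by auto
      then have "Least P \<le> degree (q mod g)" by (rule Least_le)
      with \<open>degree (q mod g) < degree g\<close> g(3) show False by simp
    qed
  next
    assume "g dvd q"
    then obtain s where "q = g * s" by (rule dvdE)
    then show "annihilates A q v" using annihilates_mult[OF A v g(2), of s] by (simp add: mult.commute)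
  qed
  with g(1) have "generates_annihilator A v g" unfolding generates_annihilator_def by blast
  then show thesis by (rule that)
qed

lemma generates_annihilator_degree_le:
  assumes A: "A \<in> carrier_mat n n" and v: "v \<in> carrier_vec n" and g: "generates_annihilator A v g"
  shows "degree g \<le> n"
proof -
  obtain q where q: "q \<noteq> 0" "degree q \<le> n" "annihilates A q v" using annihilator_exists[OF A v] by auto
  with g have "g dvd q" unfolding generates_annihilator_def by auto
  then have "degree g \<le> degree q" using q(1) by (rule dvd_imp_degree_le)
  with q(2) show ?thesis by simp
qed

lemma generates_annihilator_poly_mat_mult_vec:
  assumes A: "A \<in> carrier_mat n n" and v: "v \<in> carrier_vec n"
    and g: "generates_annihilator A v (p * a)"
  shows "generates_annihilator A (poly_mat p A *\<^sub>v v) a"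
proof -
  have p: "p \<noteq> 0" and a: "a \<noteq> 0" using g unfolding generates_annihilator_def by auto
  have "annihilates A q (poly_mat p A *\<^sub>v v) \<longleftrightarrow> a dvd q" for q
  proof -
    have "annihilates A q (poly_mat p A *\<^sub>v v) \<longleftrightarrow> p * a dvd q * p"
      using g unfolding annihilates_poly_mat_mult_vec[OF A v] generates_annihilator_def by blast
    also have "\<dots> \<longleftrightarrow> a dvd q"
      using p by (simp add: mult.commute[of q])
    finally show ?thesis .
  qed
  with a show ?thesis unfolding generates_annihilator_def by blast
qed

lemma dvd_prime_power_mult_cancel:
  fixes \<pi> a b :: "'a :: field poly"
  assumes \<pi>: "field_poly.prime \<pi>" and a: "\<not> \<pi> dvd a" and dvd: "a dvd \<pi> ^ m * b" and b: "b \<noteq> 0"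
  shows "a dvd b"
proof -
  have \<pi>0: "\<pi> \<noteq> 0" using \<pi> not_prime_elem_zero unfolding field_poly.prime_def by blast
  have a0: "a \<noteq> 0" using dvd \<pi>0 b by auto
  show ?thesis
  proof (rule field_poly.multiplicity_le_imp_dvd[OF a0])
    fix p :: "'a poly" assume p: "field_poly.prime p"
    show "field_poly.multiplicity p a \<le> field_poly.multiplicity p b"
    proof (cases "p = \<pi>")
      case True
      then show ?thesis using a by (simp add: field_poly.not_dvd_imp_multiplicity_0)
    next
      case False
      have pe: "prime_elem p" using p by (simp add: field_poly.prime_def)
      have "field_poly.multiplicity p a \<le> field_poly.multiplicity p (\<pi> ^ m * b)"
        by (rule field_poly.dvd_imp_multiplicity_le[OF dvd]) (use \<pi>0 b in simp)
      also have "\<dots> = field_poly.multiplicity p b"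
        using field_poly.prime_elem_multiplicity_mult_distrib[OF pe _ b, of "\<pi> ^ m"]
          field_poly.prime_elem_multiplicity_power_distrib[OF pe \<pi>0]
          field_poly.prime_multiplicity_other[OF p \<pi> False] \<pi>0 by simp
      finally show ?thesis .
    qed
  qed
qed

lemma annihilator_of_sum_dvd:
  assumes A: "A \<in> carrier_mat n n" and v: "v \<in> carrier_vec n" and w: "w \<in> carrier_vec n"
    and gv: "generates_annihilator A v a" and gw: "generates_annihilator A w (\<pi> ^ e)"
    and \<pi>: "field_poly.prime \<pi>" and a: "\<not> \<pi> dvd a"
    and q: "annihilates A q (v + w)"
  shows "\<pi> ^ e * a dvd q"
proof (cases "q = 0")
  case False
  have vw: "v + w = w + v" using v w by (rule comm_add_vec)
  have "annihilates A (a * q) (v + w)" by (rule annihilates_mult[OF A _ q]) (use v w in simp)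
  moreover have "annihilates A (a * q) v" using gv unfolding generates_annihilator_def by simp
  ultimately have "annihilates A (a * q) w" using annihilates_add_vec[OF A v w] by blast
  then have "\<pi> ^ e dvd a * q" using gw unfolding generates_annihilator_def by blast
  then have "\<pi> ^ e dvd q"
    using prime_power_dvd_multD[of \<pi> e a q] \<pi> a by (cases e) (auto simp: field_poly.prime_def)
  then obtain r where r: "q = \<pi> ^ e * r" by (rule dvdE)
  then have "annihilates A q w" using gw unfolding generates_annihilator_def by simp
  with q have "annihilates A q v" using annihilates_add_vec[OF A w v] vw by metis
  then have "a dvd \<pi> ^ e * r" using gv r unfolding generates_annihilator_def by simp
  then have "a dvd r" by (rule dvd_prime_power_mult_cancel[OF \<pi> a]) (use False r in simp)
  with r show ?thesis by simp
qed simp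

lemma annihilator_of_larger_degree:
  assumes A: "A \<in> carrier_mat n n" and v: "v \<in> carrier_vec n" and w: "w \<in> carrier_vec n"
    and gv: "generates_annihilator A v g" and gw: "generates_annihilator A w h" and ndvd: "\<not> h dvd g"
  obtains u g' where "u \<in> carrier_vec n" "generates_annihilator A u g'" "degree g < degree g'"
proof -
  have g0: "g \<noteq> 0" and h0: "h \<noteq> 0" using gv gw unfolding generates_annihilator_def by auto
  obtain \<pi> where \<pi>: "field_poly.prime \<pi>"
    and lt: "field_poly.multiplicity \<pi> g < field_poly.multiplicity \<pi> h"
    using ndvd field_poly.multiplicity_le_imp_dvd[OF h0, of g] by (meson not_le)
  define f where "f = field_poly.multiplicity \<pi> g"
  define e where "e = field_poly.multiplicity \<pi> h"
  have \<pi>0: "\<pi> \<noteq> 0" and \<pi>1: "\<not> is_unit \<pi>"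
    using \<pi> prime_elem_not_unit not_prime_elem_zero unfolding field_poly.prime_def by blast+
  obtain a where ga: "g = \<pi> ^ f * a" and a: "\<not> \<pi> dvd a"
    using field_poly.multiplicity_decompose'[OF g0 \<pi>1] unfolding f_def by blast
  obtain b where hb: "h = b * \<pi> ^ e"
    using field_poly.multiplicity_dvd[of \<pi> h] unfolding e_def by (metis dvd_def mult.commute)
  \<comment> \<open>The summands of u have annihilators a (the \<pi>-free part of g) and \<pi> ^ e.\<close>
  define u where "u = poly_mat (\<pi> ^ f) A *\<^sub>v v + poly_mat b A *\<^sub>v w"
  have u: "u \<in> carrier_vec n" unfolding u_def using A v w by simp
  obtain g' where g': "generates_annihilator A u g'" using generates_annihilator_exists[OF A u] .
  then have "g' \<noteq> 0" and ann: "annihilates A g' u" unfolding generates_annihilator_def by auto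
  have "\<pi> ^ e * a dvd g'"
    using annihilator_of_sum_dvd[OF A _ _ generates_annihilator_poly_mat_mult_vec[OF A v gv[unfolded ga]]
        generates_annihilator_poly_mat_mult_vec[OF A w gw[unfolded hb]] \<pi> a ann[unfolded u_def]] A v w
    by simp
  then have "degree (\<pi> ^ e * a) \<le> degree g'" using \<open>g' \<noteq> 0\<close> by (rule dvd_imp_degree_le)
  moreover have "degree g < degree (\<pi> ^ e * a)"
  proof -
    have "0 < degree \<pi>" using \<pi>0 \<pi>1 is_unit_iff_degree by auto
    then have "f * degree \<pi> < e * degree \<pi>" using lt unfolding f_def e_def by simp
    then show ?thesis using ga g0 \<pi>0 by (auto simp: degree_mult_eq degree_power_eq)
  qed
  ultimately show thesis using u g' that by simp
qed

lemma generates_annihilator_of_whole_space: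
  assumes A: "A \<in> carrier_mat n n"
  obtains v g where "v \<in> carrier_vec n" "generates_annihilator A v g" "poly_mat g A = 0\<^sub>m n n"
proof -
  define S where "S = {d. \<exists>v \<in> carrier_vec n. \<exists>g. generates_annihilator A v g \<and> degree g = d}"
  have S: "finite S" "S \<noteq> {}"
  proof -
    have "S \<subseteq> {..n}" unfolding S_def using generates_annihilator_degree_le[OF A] by auto
    then show "finite S" using finite_subset by blast
    obtain g where "generates_annihilator A (0\<^sub>v n) g"
      using generates_annihilator_exists[OF A, of "0\<^sub>v n"] by auto
    then have "degree g \<in> S" unfolding S_def by (intro CollectI bexI[of _ "0\<^sub>v n"]) auto
    then show "S \<noteq> {}" by blast
  qed
  then have "Max S \<in> S" by simp
  then obtain v g where v: "v \<in> carrier_vec n" and g: "generates_annihilator A v g"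
    and max: "degree g = Max S" unfolding S_def by auto
  have "annihilates A g w" if w: "w \<in> carrier_vec n" for w
  proof -
    obtain h where h: "generates_annihilator A w h" using generates_annihilator_exists[OF A w] .
    have "h dvd g"
    proof (rule ccontr)
      assume "\<not> h dvd g"
      then obtain u g' where "u \<in> carrier_vec n" "generates_annihilator A u g'" "degree g < degree g'"
        by (rule annihilator_of_larger_degree[OF A v w g h])
      then have "degree g' \<in> S" "Max S < degree g'" unfolding S_def max by auto
      with S(1) show False using Max_ge leD by blast
    qed
    with h show ?thesis unfolding generates_annihilator_def by blast
  qed
  then have "poly_mat g A = 0\<^sub>m n n"
    using A by (intro mat_eq_zero_if_unit_vecs) (auto simp: annihilates_def)
  with v g show thesis by (rule that)
qed

lemma is_minimal_poly_unique:
  assumes A: "A \<in> carrier_mat n n" and p: "is_minimal_poly A p" and p': "is_minimal_poly A p'"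
  shows "p = p'"
proof (rule ccontr)
  assume ne: "p \<noteq> p'"
  have monic: "monic p" "monic p'" and zero: "poly_mat p A = 0\<^sub>m n n" "poly_mat p' A = 0\<^sub>m n n"
    and least: "\<And>q. q \<noteq> 0 \<Longrightarrow> poly_mat q A = 0\<^sub>m n n \<Longrightarrow> degree p \<le> degree q"
    and least': "\<And>q. q \<noteq> 0 \<Longrightarrow> poly_mat q A = 0\<^sub>m n n \<Longrightarrow> degree p' \<le> degree q"
    using p p' A unfolding is_minimal_poly_def by auto
  have "p \<noteq> 0" "p' \<noteq> 0" using monic by auto
  then have "degree p \<le> degree p'" "degree p' \<le> degree p"
    using least[OF _ zero(2)] least'[OF _ zero(1)] by auto
  then have deg: "degree p' = degree p" by simp
  have "p - p' \<noteq> 0" "poly_mat (p - p') A = 0\<^sub>m n n"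
    using ne zero A by (auto simp: poly_mat_diff[OF A])
  then have "degree p \<le> degree (p - p')" by (rule least)
  moreover have "degree (p - p') < degree p"
  proof (rule degree_lessI)
    show "\<forall>k\<ge>degree p. coeff (p - p') k = 0"
    proof (intro allI impI)
      fix k assume "degree p \<le> k"
      then show "coeff (p - p') k = 0" using monic deg by (cases "k = degree p") (auto simp: coeff_eq_0)
    qed
  qed (use ne in simp)
  ultimately show False by simp
qed

lemma is_minimal_poly_minimal_poly:
  assumes A: "A \<in> carrier_mat n n"
  shows "is_minimal_poly A (minimal_poly A)"
proof -
  obtain v g where "generates_annihilator A v g" and g: "poly_mat g A = 0\<^sub>m n n"
    using generates_annihilator_of_whole_space[OF A] .
  then have "g \<noteq> 0" unfolding generates_annihilator_def by simp
  define P where "P = (\<lambda>d. \<exists>q. q \<noteq> 0 \<and> poly_mat q A = 0\<^sub>m n n \<and> degree q = d)"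
  have "P (degree g)" unfolding P_def using \<open>g \<noteq> 0\<close> g by auto
  then have "P (Least P)" by (rule LeastI)
  then obtain q where q: "q \<noteq> 0" "poly_mat q A = 0\<^sub>m n n" "degree q = Least P"
    unfolding P_def by auto
  define p where "p = Polynomial.smult (inverse (lead_coeff q)) q"
  have "is_minimal_poly A p"
    unfolding is_minimal_poly_def
  proof (intro conjI allI impI)
    show "monic p" using q(1) by (simp add: p_def)
    show "poly_mat p A = 0\<^sub>m (dim_row A) (dim_row A)" using q(2) A by (simp add: p_def poly_mat_smult[OF A])
    fix r assume "r \<noteq> 0 \<and> poly_mat r A = 0\<^sub>m (dim_row A) (dim_row A)"
    then have "P (degree r)" using A unfolding P_def by auto
    then have "Least P \<le> degree r" by (rule Least_le)
    then show "degree p \<le> degree r" using q(1,3) by (simp add: p_def)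
  qed
  then have "\<exists>!p. is_minimal_poly A p" using is_minimal_poly_unique[OF A] by blast
  then show ?thesis unfolding minimal_poly_def by (rule theI')
qed

lemma non_derogative_annihilating_degree:
  assumes A: "A \<in> carrier_mat n n" and nd: "non_derogative A"
    and q: "q \<noteq> 0" "poly_mat q A = 0\<^sub>m n n"
  shows "n \<le> degree q"
proof -
  have "degree (minimal_poly A) \<le> degree q"
    using is_minimal_poly_minimal_poly[OF A] q A unfolding is_minimal_poly_def by auto
  moreover have "degree (minimal_poly A) = n"
    using nd degree_monic_char_poly[OF A] unfolding non_derogative_def by simp
  ultimately show ?thesis by simp
qed

definition is_cyclic_vector :: "'a :: field mat \<Rightarrow> 'a vec \<Rightarrow> bool" where
  "is_cyclic_vector A v \<longleftrightarrow>
     (\<forall>q. q \<noteq> 0 \<longrightarrow> degree q < dim_row A \<longrightarrow> poly_mat q A *\<^sub>v v \<noteq> 0\<^sub>v (dim_row A))"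

lemma non_derogative_cyclic_vector:
  assumes A: "A \<in> carrier_mat n n" and nd: "non_derogative A"
  obtains v where "v \<in> carrier_vec n" "is_cyclic_vector A v"
proof -
  obtain v g where v: "v \<in> carrier_vec n" and g: "generates_annihilator A v g" "poly_mat g A = 0\<^sub>m n n"
    using generates_annihilator_of_whole_space[OF A] .
  have "n \<le> degree g"
    using non_derogative_annihilating_degree[OF A nd _ g(2)] g(1) unfolding generates_annihilator_def by auto
  moreover have "degree g \<le> degree q" if "q \<noteq> 0" "annihilates A q v" for q
  proof -
    from g(1) that(2) have "g dvd q" unfolding generates_annihilator_def by blast
    then show ?thesis using that(1) by (rule dvd_imp_degree_le)
  qed
  ultimately have "is_cyclic_vector A v"
    using A unfolding is_cyclic_vector_def annihilates_def by fastforce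
  with v show thesis by (rule that)
qed

section \<open>Similarity and diagonalizability\<close>

lemma diagonalizable_similar:
  assumes sim: "similar_mat A B" and diag: "diagonalizable B"
  shows "diagonalizable A"
proof -
  obtain n P Q where PQ: "{A, B, P, Q} \<subseteq> carrier_mat n n" "P * Q = 1\<^sub>m n" "Q * P = 1\<^sub>m n"
    and A: "A = P * B * Q"
    using similar_matD[OF sim] by blast
  then have dims: "dim_row A = n" "dim_row B = n" by auto
  obtain U V where UV: "U \<in> carrier_mat n n" "V \<in> carrier_mat n n" "U * V = 1\<^sub>m n" "V * U = 1\<^sub>m n"
    and VBU: "diagonal_mat (V * B * U)"
    using diag unfolding diagonalizable_def dims by blast
  have C: "P \<in> carrier_mat n n" "Q \<in> carrier_mat n n" "B \<in> carrier_mat n n" using PQ by auto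
  have "(V * Q) * A * (P * U) = V * (Q * P) * B * ((Q * P) * U)"
    unfolding A using C UV(1,2) by (simp add: assoc_mult_mat[of _ n n _ n _ n])
  also have "\<dots> = V * B * U" using C UV PQ by simp
  finally have "diagonal_mat ((V * Q) * A * (P * U))" using VBU by simp
  moreover have "(P * U) * (V * Q) = 1\<^sub>m n"
  proof -
    have "(P * U) * (V * Q) = P * ((U * V) * Q)" using C UV(1,2) by (simp add: assoc_mult_mat[of _ n n _ n _ n])
    also have "\<dots> = 1\<^sub>m n" using C UV PQ by simp
    finally show ?thesis .
  qed
  moreover have "(V * Q) * (P * U) = 1\<^sub>m n"
  proof -
    have "(V * Q) * (P * U) = V * ((Q * P) * U)" using C UV(1,2) by (simp add: assoc_mult_mat[of _ n n _ n _ n])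
    also have "\<dots> = 1\<^sub>m n" using C UV PQ by simp
    finally show ?thesis .
  qed
  moreover have "P * U \<in> carrier_mat n n" "V * Q \<in> carrier_mat n n" using C UV by auto
  ultimately show ?thesis unfolding diagonalizable_def dims by blast
qed

lemma eigenvalue_similar:
  assumes sim: "similar_mat (A :: 'a :: field mat) B"
  shows "eigenvalue A e \<longleftrightarrow> eigenvalue B e"
proof -
  obtain n P Q where "{A, B, P, Q} \<subseteq> carrier_mat n n"
    using similar_matD[OF sim] by blast
  then have "A \<in> carrier_mat n n" "B \<in> carrier_mat n n" by auto
  then show ?thesis
    by (simp add: eigenvalue_root_char_poly[of A n] eigenvalue_root_char_poly[of B n] char_poly_similar[OF sim])
qed

lemma eigenvalue_mat_diag:
  fixes d :: "nat \<Rightarrow> 'a :: field"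
  assumes "eigenvalue (mat_diag n d) e"
  shows "e \<in> d ` {..<n}"
proof -
  have "char_poly (mat_diag n d) = (\<Prod>a\<leftarrow>map d [0..<n]. [:- a, 1:])"
    by (subst char_poly_upper_triangular[of _ n])
      (auto simp: upper_triangular_def mat_diag_def diag_mat_def intro!: arg_cong[of _ _ prod_list] map_cong)
  moreover have "poly (\<Prod>a\<leftarrow>map d xs. [:- a, 1:]) e = (\<Prod>a\<leftarrow>map d xs. e - a)" for xs
    by (induct xs) (auto simp: algebra_simps)
  ultimately have "(\<Prod>a\<leftarrow>map d [0..<n]. e - a) = 0"
    using assms eigenvalue_root_char_poly[OF mat_diag_dim, of n d e] by simp
  then show ?thesis by auto
qed

lemma diagonalizable_mat_diag: "diagonalizable (mat_diag n d)"
  unfolding diagonalizable_def by (intro exI[of _ "1\<^sub>m n"]) (simp add: diagonal_mat_def mat_diag_def)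

lemma eigenbasis_similar_mat_diag:
  assumes D: "(D :: 'a :: field mat) \<in> carrier_mat n n" and U: "U \<in> carrier_mat n n" and det: "det U \<noteq> 0"
    and eig: "\<And>j. j < n \<Longrightarrow> D *\<^sub>v col U j = d j \<cdot>\<^sub>v col U j"
  shows "similar_mat D (mat_diag n d)"
proof -
  obtain V where V: "V \<in> carrier_mat n n" "U * V = 1\<^sub>m n" "V * U = 1\<^sub>m n"
    using inverse_mat_if_det_nonzero[OF U det] .
  have DU: "D * U = U * mat_diag n d"
  proof (rule eq_matI)
    fix i j assume "i < dim_row (U * mat_diag n d)" "j < dim_col (U * mat_diag n d)"
    with U have ij: "i < n" "j < n" by (auto simp: mat_diag_def)
    have "(D * U) $$ (i, j) = (D *\<^sub>v col U j) $ i" using D U ij by simp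
    also have "\<dots> = d j * U $$ (i, j)" using eig[OF ij(2)] U ij by simp
    finally show "(D * U) $$ (i, j) = (U * mat_diag n d) $$ (i, j)"
      using U ij by (simp add: mat_diag_mult_right[OF U])
  qed (use D U in \<open>auto simp: mat_diag_def\<close>)
  have "D = D * (U * V)" using D V by simp
  also have "\<dots> = (D * U) * V" using D U V(1) by (simp add: assoc_mult_mat[of _ n n _ n _ n])
  also have "\<dots> = U * mat_diag n d * V" unfolding DU ..
  finally show ?thesis using D U V by (intro similar_matI) auto
qed

definition square_zero_plus_diagonalizable :: "'a :: field mat \<Rightarrow> 'a set \<Rightarrow> bool" where
  "square_zero_plus_diagonalizable B S \<longleftrightarrow> (\<exists>N D.
     N \<in> carrier_mat (dim_row B) (dim_row B) \<and> D \<in> carrier_mat (dim_row B) (dim_row B) \<and>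
     B = N + D \<and> N * N = 0\<^sub>m (dim_row B) (dim_row B) \<and>
     diagonalizable D \<and> (\<forall>e. eigenvalue D e \<longrightarrow> e \<in> S))"

lemma square_zero_plus_diagonalizable_mono:
  "square_zero_plus_diagonalizable B S \<Longrightarrow> S \<subseteq> T \<Longrightarrow> square_zero_plus_diagonalizable B T"
  unfolding square_zero_plus_diagonalizable_def by blast

lemma square_zero_plus_diagonalizable_similar:
  assumes sim: "similar_mat B M" and split: "square_zero_plus_diagonalizable M S"
  shows "square_zero_plus_diagonalizable B S"
proof -
  obtain n P Q where PQ: "{B, M, P, Q} \<subseteq> carrier_mat n n" "P * Q = 1\<^sub>m n" "Q * P = 1\<^sub>m n"
    and B: "B = P * M * Q"
    using similar_matD[OF sim] by blast
  then have C: "P \<in> carrier_mat n n" "Q \<in> carrier_mat n n" and dims: "dim_row B = n" "dim_row M = n"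
    by auto
  obtain N D where ND: "N \<in> carrier_mat n n" "D \<in> carrier_mat n n" and M: "M = N + D"
    and N: "N * N = 0\<^sub>m n n" and D: "diagonalizable D" "\<And>e. eigenvalue D e \<Longrightarrow> e \<in> S"
    using split unfolding square_zero_plus_diagonalizable_def dims by blast
  have "B = P * N * Q + P * D * Q"
    unfolding B M using C ND
    by (simp add: mult_add_distrib_mat[of _ n n] add_mult_distrib_mat[of _ n n])
  moreover have "(P * N * Q) * (P * N * Q) = 0\<^sub>m n n"
  proof -
    have "(P * N * Q) * (P * N * Q) = P * N * (Q * P) * N * Q"
      using C ND by (simp add: assoc_mult_mat[of _ n n _ n _ n])
    also have "\<dots> = P * (N * N) * Q" using C ND PQ by (simp add: assoc_mult_mat[of _ n n _ n _ n])
    finally show ?thesis using C N by simp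
  qed
  moreover have sim_D: "similar_mat (P * D * Q) D"
    using C ND PQ by (intro similar_matI[of _ _ P Q n]) auto
  then have "diagonalizable (P * D * Q)" "\<And>e. eigenvalue (P * D * Q) e \<Longrightarrow> e \<in> S"
    using diagonalizable_similar D eigenvalue_similar by blast+
  moreover have "P * N * Q \<in> carrier_mat n n" "P * D * Q \<in> carrier_mat n n" using C ND by auto
  ultimately show ?thesis unfolding square_zero_plus_diagonalizable_def dims by blast
qed

lemma mat_trace_mult_comm:
  assumes A: "(A :: 'a :: comm_ring_1 mat) \<in> carrier_mat n m" and B: "B \<in> carrier_mat m n"
  shows "mat_trace (A * B) = mat_trace (B * A)"
proof -
  have "mat_trace (A * B) = (\<Sum>i<n. \<Sum>l<m. A $$ (i, l) * B $$ (l, i))"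
    unfolding mat_trace_def using A B by (auto simp: scalar_prod_def atLeast0LessThan intro!: sum.cong)
  also have "\<dots> = (\<Sum>l<m. \<Sum>i<n. B $$ (l, i) * A $$ (i, l))"
    by (subst sum.swap) (simp add: mult.commute)
  also have "\<dots> = mat_trace (B * A)"
    unfolding mat_trace_def using A B by (auto simp: scalar_prod_def atLeast0LessThan intro!: sum.cong)
  finally show ?thesis .
qed

lemma mat_trace_similar:
  assumes "similar_mat (A :: 'a :: comm_ring_1 mat) B"
  shows "mat_trace A = mat_trace B"
proof -
  obtain n P Q where PQ: "{A, B, P, Q} \<subseteq> carrier_mat n n" "Q * P = 1\<^sub>m n" and A: "A = P * B * Q"
    using similar_matD[OF assms] by blast
  then have C: "P \<in> carrier_mat n n" "Q \<in> carrier_mat n n" "B \<in> carrier_mat n n" by auto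
  have "mat_trace A = mat_trace (Q * (P * B))"
    unfolding A using C by (intro mat_trace_mult_comm[of _ n n]) auto
  also have "Q * (P * B) = B" using C PQ by (simp add: assoc_mult_mat[of _ n n _ n _ n, symmetric])
  finally show ?thesis .
qed

section \<open>Newton bases of cyclic vectors\<close>

lemma smult_sum_monic_eq_0:
  fixes q :: "nat \<Rightarrow> 'a :: comm_ring_1 poly"
  assumes q: "\<And>j. degree (q j) = j" "\<And>j. lead_coeff (q j) = 1"
    and sum: "(\<Sum>j<m. Polynomial.smult (x j) (q j)) = 0" and j: "j < m"
  shows "x j = 0"
  using sum j
proof (induct m arbitrary: j)
  case (Suc m)
  have "coeff (\<Sum>j<Suc m. Polynomial.smult (x j) (q j)) m = x m"
    using q by (simp add: coeff_sum coeff_eq_0)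
  with Suc.prems(1) have "x m = 0" by simp
  with Suc show ?case by (cases "j = m") auto
qed simp

(* The matrix of A in the basis (A - mu_0) ... (A - mu_(j-1)) v, j < n, of a cyclic vector v;
   nothing is required of its last column. *)
definition newton_form :: "nat \<Rightarrow> (nat \<Rightarrow> 'a :: comm_ring_1) \<Rightarrow> 'a mat \<Rightarrow> bool" where
  "newton_form n \<mu> M \<longleftrightarrow> M \<in> carrier_mat n n \<and>
     (\<forall>i j. i < n \<longrightarrow> Suc j < n \<longrightarrow> M $$ (i, j) = (if i = j then \<mu> j else if i = Suc j then 1 else 0))"

lemma newton_form_trace:
  assumes M: "newton_form (Suc m) \<mu> M"
  shows "mat_trace M = (\<Sum>j<m. \<mu> j) + M $$ (m, m)"
proof -
  have "dim_row M = Suc m" and diag: "\<And>j. j < m \<Longrightarrow> M $$ (j, j) = \<mu> j"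
    using M unfolding newton_form_def by auto
  then show ?thesis unfolding mat_trace_def by (simp add: sum.cong[OF refl diag])
qed

locale newton_basis =
  fixes A :: "'a :: field mat" and n :: nat and v :: "'a vec" and \<mu> :: "nat \<Rightarrow> 'a"
  assumes A: "A \<in> carrier_mat n n" and v: "v \<in> carrier_vec n" and cyclic: "is_cyclic_vector A v"
begin

definition newton_poly :: "nat \<Rightarrow> 'a poly" where
  "newton_poly j = (\<Prod>i<j. [:- \<mu> i, 1:])"

definition newton_vec :: "nat \<Rightarrow> 'a vec" where
  "newton_vec j = poly_mat (newton_poly j) A *\<^sub>v v"

definition W :: "'a mat" where
  "W = mat n n (\<lambda>(i, j). newton_vec j $ i)"

lemma newton_vec_carrier [simp]: "newton_vec j \<in> carrier_vec n"
  unfolding newton_vec_def using A v by simp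

lemma newton_vec_dim [simp]: "dim_vec (newton_vec j) = n"
  using newton_vec_carrier[of j] by (simp del: newton_vec_carrier)

lemma W_carrier [simp]: "W \<in> carrier_mat n n"
  unfolding W_def by simp

lemma W_dim [simp]: "dim_row W = n" "dim_col W = n"
  unfolding W_def by simp_all

lemma W_mult_unit_vec: "j < n \<Longrightarrow> W *\<^sub>v unit_vec n j = newton_vec j"
  by (simp add: mult_mat_vec_unit_vec[OF W_carrier]) (auto simp: W_def intro!: eq_vecI)

lemma newton_poly_Suc: "newton_poly (Suc j) = [:- \<mu> j, 1:] * newton_poly j"
  unfolding newton_poly_def by (simp add: mult.commute)

lemma newton_poly_monic: "degree (newton_poly j) = j" "lead_coeff (newton_poly j) = 1"
proof (induct j)
  case (Suc j)
  then have "newton_poly j \<noteq> 0" by auto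
  then show "degree (newton_poly (Suc j)) = Suc j"
    using Suc unfolding newton_poly_Suc by (simp add: degree_mult_eq del: mult_pCons_left)
  show "lead_coeff (newton_poly (Suc j)) = 1"
    using Suc unfolding newton_poly_Suc lead_coeff_mult by simp
qed (simp_all add: newton_poly_def)

lemma A_mult_newton_vec: "A *\<^sub>v newton_vec j = \<mu> j \<cdot>\<^sub>v newton_vec j + newton_vec (Suc j)"
proof -
  have "newton_vec (Suc j) = (A - \<mu> j \<cdot>\<^sub>m 1\<^sub>m n) *\<^sub>v newton_vec j"
    unfolding newton_vec_def newton_poly_Suc poly_mat_mult[OF A] poly_mat_linear[OF A]
    by (rule assoc_mult_mat_vec[of _ n n _ n]) (use A v in auto)
  also have "\<dots> = A *\<^sub>v newton_vec j - \<mu> j \<cdot>\<^sub>v newton_vec j"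
    by (rule minus_smult_one_mult_vec[OF A newton_vec_carrier])
  finally show ?thesis using A by (intro eq_vecI) auto
qed

lemma W_mult_vec:
  assumes x: "x \<in> carrier_vec n"
  shows "W *\<^sub>v x = poly_mat (\<Sum>j<n. Polynomial.smult (x $ j) (newton_poly j)) A *\<^sub>v v"
proof (rule eq_vecI)
  let ?p = "\<Sum>j<n. Polynomial.smult (x $ j) (newton_poly j)"
  fix i assume "i < dim_vec (poly_mat ?p A *\<^sub>v v)"
  with A have i: "i < n" by simp
  have deg: "degree (newton_poly j) < n" if "j < n" for j using that newton_poly_monic by simp
  have "degree ?p < n"
    by (rule degree_lessI) (use i in \<open>auto simp: coeff_sum coeff_eq_0 newton_poly_monic intro!: sum.neutral\<close>)
  then have "(poly_mat ?p A *\<^sub>v v) $ i = (\<Sum>l<n. \<Sum>j<n. x $ j * (coeff (newton_poly j) l * (A ^\<^sub>m l *\<^sub>v v) $ i))"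
    by (simp add: poly_mat_mult_vec_index[OF A v i] coeff_sum sum_distrib_right mult.assoc)
  also have "\<dots> = (\<Sum>j<n. x $ j * newton_vec j $ i)"
    by (subst sum.swap) (simp add: newton_vec_def poly_mat_mult_vec_index[OF A v i deg] sum_distrib_left)
  also have "\<dots> = (W *\<^sub>v x) $ i"
    using i x unfolding W_def by (auto simp: scalar_prod_def atLeast0LessThan mult.commute intro!: sum.cong)
  finally show "(W *\<^sub>v x) $ i = (poly_mat ?p A *\<^sub>v v) $ i" ..
qed (use A in simp)

lemma W_injective:
  assumes x: "x \<in> carrier_vec n" and Wx: "W *\<^sub>v x = 0\<^sub>v n"
  shows "x = 0\<^sub>v n"
proof -
  let ?p = "\<Sum>j<n. Polynomial.smult (x $ j) (newton_poly j)"
  have "degree ?p < n \<or> n = 0"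
    by (cases n) (auto intro!: degree_lessI simp: coeff_sum coeff_eq_0 newton_poly_monic)
  then have "?p = 0"
    using cyclic Wx A unfolding is_cyclic_vector_def W_mult_vec[OF x] by auto
  then show ?thesis
    using smult_sum_monic_eq_0[OF newton_poly_monic, where m = n and x = "\<lambda>j. x $ j"] x
    by (intro eq_vecI) auto
qed

lemma similar_newton_form: "\<exists>M. similar_mat A M \<and> newton_form n \<mu> M"
proof -
  have "det W \<noteq> 0" using det_0_iff_vec_prod_zero_field[OF W_carrier] W_injective by blast
  then obtain Wi where Wi: "Wi \<in> carrier_mat n n" "W * Wi = 1\<^sub>m n" "Wi * W = 1\<^sub>m n"
    by (rule inverse_mat_if_det_nonzero[OF W_carrier])
  define M where "M = Wi * A * W"
  have M: "M \<in> carrier_mat n n"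
    unfolding M_def by (rule mult_carrier_mat[OF mult_carrier_mat[OF Wi(1) A] W_carrier])
  have "similar_mat M A" using Wi A M by (intro similar_matI[of _ _ Wi W n]) (auto simp: M_def)
  then have "similar_mat A M" by (rule similar_mat_sym)
  moreover have "M $$ (i, j) = (if i = j then \<mu> j else if i = Suc j then 1 else 0)"
    if ij: "i < n" "Suc j < n" for i j
  proof -
    have Wi_newton_vec: "Wi *\<^sub>v newton_vec l = unit_vec n l" if "l < n" for l
      using that Wi by (simp add: W_mult_unit_vec[symmetric] assoc_mult_mat_vec[symmetric, of _ n n _ n])
    have "M *\<^sub>v unit_vec n j = Wi *\<^sub>v (A *\<^sub>v newton_vec j)"
      unfolding M_def using Wi A ij by (simp add: W_mult_unit_vec assoc_mult_mat_vec[of _ n n _ n])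
    also have "\<dots> = \<mu> j \<cdot>\<^sub>v unit_vec n j + unit_vec n (Suc j)"
      using Wi ij by (simp add: A_mult_newton_vec mult_add_distrib_mat_vec[of _ n n] mult_mat_vec[of _ n n]
          Wi_newton_vec)
    finally have "col M j = \<mu> j \<cdot>\<^sub>v unit_vec n j + unit_vec n (Suc j)"
      using mult_mat_vec_unit_vec[OF M, of j] ij by simp
    then have "M $$ (i, j) = (\<mu> j \<cdot>\<^sub>v unit_vec n j + unit_vec n (Suc j)) $ i"
      using M ij by (metis Suc_lessD carrier_matD index_col)
    then show ?thesis using ij by auto
  qed
  ultimately show ?thesis using M unfolding newton_form_def by blast
qed

end

section \<open>Newton forms with alternating shifts\<close>

locale alternating_newton_form =
  fixes M :: "'a :: field mat" and n m :: nat and \<alpha> \<gamma> :: 'a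
  assumes newton: "newton_form n (\<lambda>j. if even j then \<alpha> else \<alpha> - 1) M"
    and n: "n = Suc (2 * m)" and last: "M $$ (2 * m, 2 * m) = \<gamma>"
    and \<gamma>_\<alpha>: "\<gamma> \<noteq> \<alpha>" and \<gamma>_\<beta>: "\<gamma> \<noteq> \<alpha> - 1"
begin

lemma M_carrier [simp]: "M \<in> carrier_mat n n"
  using newton unfolding newton_form_def by simp

lemma M_dim [simp]: "dim_row M = n" "dim_col M = n"
  using M_carrier by blast+

lemma M_index:
  "i < n \<Longrightarrow> Suc j < n \<Longrightarrow> M $$ (i, j) = (if i = j then (if even j then \<alpha> else \<alpha> - 1) else if i = Suc j then 1 else 0)"
  using newton unfolding newton_form_def by blast

lemma last_index_less: "2 * m < n"
  using n by simp

definition N0 :: "'a mat" where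
  "N0 = mat n n (\<lambda>(i, j). if odd j \<and> i = Suc j then 1 else 0)"

definition D0 :: "'a mat" where
  "D0 = M - N0"

lemma N0_dim [simp]: "dim_row N0 = n" "dim_col N0 = n"
  unfolding N0_def by simp_all

lemma D0_dim [simp]: "dim_row D0 = n" "dim_col D0 = n"
  unfolding D0_def by simp_all

lemma N0_carrier [simp]: "N0 \<in> carrier_mat n n"
  by (simp add: carrier_matI)

lemma D0_carrier [simp]: "D0 \<in> carrier_mat n n"
  by (simp add: carrier_matI)

lemma N0_square: "N0 * N0 = 0\<^sub>m n n"
proof (rule eq_matI)
  fix i j assume "i < dim_row (0\<^sub>m n n :: 'a mat)" "j < dim_col (0\<^sub>m n n :: 'a mat)"
  then have ij: "i < n" "j < n" by auto
  have "(N0 * N0) $$ (i, j) = (\<Sum>l<n. N0 $$ (i, l) * N0 $$ (l, j))"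
    using ij by (simp add: scalar_prod_def atLeast0LessThan)
  also have "\<dots> = 0" by (rule sum.neutral) (use ij in \<open>auto simp: N0_def\<close>)
  finally show "(N0 * N0) $$ (i, j) = 0\<^sub>m n n $$ (i, j)" using ij by simp
qed auto

lemma D0_index:
  assumes "i < n" "Suc j < n"
  shows "D0 $$ (i, j) = (if i = j then (if even j then \<alpha> else \<alpha> - 1) else if i = Suc j \<and> even j then 1 else 0)"
  using assms by (simp add: D0_def N0_def M_index)

lemma D0_last_row:
  assumes "j < n"
  shows "D0 $$ (2 * m, j) = (if j = 2 * m then \<gamma> else 0)"
proof (cases "j = 2 * m")
  case True
  then show ?thesis using last last_index_less by (simp add: D0_def N0_def)
next
  case False
  with assms n have "Suc j < n" by simp
  moreover have "\<not> (2 * m = Suc j \<and> even j)" by presburger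
  ultimately show ?thesis using False last_index_less by (simp add: D0_index)
qed

lemma D0_mult_vec_last:
  assumes x: "x \<in> carrier_vec n"
  shows "(D0 *\<^sub>v x) $ (2 * m) = \<gamma> * x $ (2 * m)"
proof -
  have "(D0 *\<^sub>v x) $ (2 * m) = (\<Sum>j<n. D0 $$ (2 * m, j) * x $ j)"
    using x last_index_less by (simp add: scalar_prod_def atLeast0LessThan)
  also have "\<dots> = (\<Sum>j<n. if j = 2 * m then \<gamma> * x $ j else 0)"
    by (rule sum.cong) (simp_all add: D0_last_row)
  finally show ?thesis using last_index_less by simp
qed

lemma D0_mult_unit_vec_odd:
  assumes "odd j" "Suc j < n"
  shows "D0 *\<^sub>v unit_vec n j = (\<alpha> - 1) \<cdot>\<^sub>v unit_vec n j"
proof (rule eq_vecI)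
  fix i assume "i < dim_vec ((\<alpha> - 1) \<cdot>\<^sub>v unit_vec n j)"
  then have i: "i < n" by simp
  then show "(D0 *\<^sub>v unit_vec n j) $ i = ((\<alpha> - 1) \<cdot>\<^sub>v unit_vec n j) $ i"
    using assms by (simp add: mult_mat_vec_unit_vec[OF D0_carrier] D0_index)
qed simp

lemma D0_mult_unit_vec_even:
  assumes "even j" "Suc j < n"
  shows "D0 *\<^sub>v unit_vec n j = \<alpha> \<cdot>\<^sub>v unit_vec n j + unit_vec n (Suc j)"
proof (rule eq_vecI)
  fix i assume "i < dim_vec (\<alpha> \<cdot>\<^sub>v unit_vec n j + unit_vec n (Suc j))"
  then have i: "i < n" by simp
  then show "(D0 *\<^sub>v unit_vec n j) $ i = (\<alpha> \<cdot>\<^sub>v unit_vec n j + unit_vec n (Suc j)) $ i"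
    using assms by (simp add: mult_mat_vec_unit_vec[OF D0_carrier] D0_index)
qed simp

lemma D0_shift_carrier [simp]: "D0 - s \<cdot>\<^sub>m 1\<^sub>m n \<in> carrier_mat n n"
  by (simp add: carrier_matI)

definition Q :: "'a mat" where
  "Q = (D0 - \<alpha> \<cdot>\<^sub>m 1\<^sub>m n) * (D0 - (\<alpha> - 1) \<cdot>\<^sub>m 1\<^sub>m n)"

lemma Q_carrier [simp]: "Q \<in> carrier_mat n n"
  unfolding Q_def by (rule mult_carrier_mat[of _ n n]) auto

lemma Q_dim [simp]: "dim_row Q = n" "dim_col Q = n"
  using Q_carrier by blast+

lemma mult_vec_carrier [simp]:
  "D0 *\<^sub>v x \<in> carrier_vec n" "(D0 - s \<cdot>\<^sub>m 1\<^sub>m n) *\<^sub>v x \<in> carrier_vec n" "Q *\<^sub>v x \<in> carrier_vec n"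
  by (auto intro: carrier_vecI)

lemma Q_mult_vec:
  assumes x: "x \<in> carrier_vec n"
  shows "Q *\<^sub>v x = (D0 - \<alpha> \<cdot>\<^sub>m 1\<^sub>m n) *\<^sub>v ((D0 - (\<alpha> - 1) \<cdot>\<^sub>m 1\<^sub>m n) *\<^sub>v x)"
  unfolding Q_def by (rule assoc_mult_mat_vec[of _ n n _ n]) (use x in auto)

lemma Q_commute: "(D0 - \<gamma> \<cdot>\<^sub>m 1\<^sub>m n) * Q = Q * (D0 - \<gamma> \<cdot>\<^sub>m 1\<^sub>m n)"
proof -
  let ?q = "[:- \<alpha>, 1:] * [:- (\<alpha> - 1), 1:]"
  have "Q = poly_mat ?q D0" unfolding Q_def poly_mat_mult[OF D0_carrier] poly_mat_linear[OF D0_carrier] ..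
  moreover have "D0 - \<gamma> \<cdot>\<^sub>m 1\<^sub>m n = poly_mat [:- \<gamma>, 1:] D0" unfolding poly_mat_linear[OF D0_carrier] ..
  moreover have "poly_mat [:- \<gamma>, 1:] D0 * poly_mat ?q D0 = poly_mat ?q D0 * poly_mat [:- \<gamma>, 1:] D0"
    by (simp only: poly_mat_mult[OF D0_carrier, symmetric] mult.commute)
  ultimately show ?thesis by simp
qed

lemma Q_mult_unit_vec:
  assumes j: "Suc j < n"
  shows "Q *\<^sub>v unit_vec n j = 0\<^sub>v n"
proof (cases "odd j")
  case True
  have "(D0 - (\<alpha> - 1) \<cdot>\<^sub>m 1\<^sub>m n) *\<^sub>v unit_vec n j = 0\<^sub>v n"
    using j by (simp add: minus_smult_one_mult_vec D0_mult_unit_vec_odd[OF True j])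
  then show ?thesis by (simp add: Q_mult_vec)
next
  case False
  have j': "Suc (Suc j) < n" using j n False by presburger
  have ev: "even j" "odd (Suc j)" using False by simp_all
  have "(D0 - (\<alpha> - 1) \<cdot>\<^sub>m 1\<^sub>m n) *\<^sub>v unit_vec n j = D0 *\<^sub>v unit_vec n j - (\<alpha> - 1) \<cdot>\<^sub>v unit_vec n j"
    by (simp add: minus_smult_one_mult_vec)
  also have "\<dots> = unit_vec n j + unit_vec n (Suc j)"
    unfolding D0_mult_unit_vec_even[OF ev(1) j] by (intro eq_vecI) (auto simp: algebra_simps)
  finally have "(D0 - (\<alpha> - 1) \<cdot>\<^sub>m 1\<^sub>m n) *\<^sub>v unit_vec n j = unit_vec n j + unit_vec n (Suc j)" .
  moreover have "(D0 - \<alpha> \<cdot>\<^sub>m 1\<^sub>m n) *\<^sub>v (unit_vec n j + unit_vec n (Suc j)) =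
      D0 *\<^sub>v unit_vec n j + D0 *\<^sub>v unit_vec n (Suc j) - \<alpha> \<cdot>\<^sub>v (unit_vec n j + unit_vec n (Suc j))"
    by (simp add: minus_smult_one_mult_vec mult_add_distrib_mat_vec[OF D0_carrier])
  moreover have "\<dots> = 0\<^sub>v n"
    unfolding D0_mult_unit_vec_even[OF ev(1) j] D0_mult_unit_vec_odd[OF ev(2) j']
    by (intro eq_vecI) (auto simp: algebra_simps)
  ultimately show ?thesis by (simp add: Q_mult_vec)
qed

lemma Q_mult_vec_eq_0:
  assumes x: "x \<in> carrier_vec n" and x_last: "x $ (2 * m) = 0"
  shows "Q *\<^sub>v x = 0\<^sub>v n"
proof (rule eq_vecI)
  fix i assume "i < dim_vec (0\<^sub>v n :: 'a vec)"
  then have i: "i < n" by simp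
  have "(Q *\<^sub>v x) $ i = (\<Sum>l<n. Q $$ (i, l) * x $ l)"
    using i x by (simp add: scalar_prod_def atLeast0LessThan)
  also have "\<dots> = 0"
  proof (rule sum.neutral, intro ballI)
    fix l assume "l \<in> {..<n}"
    then have l: "l < n" by simp
    show "Q $$ (i, l) * x $ l = 0"
    proof (cases "l = 2 * m")
      case False
      with l n have "Suc l < n" by simp
      have "Q $$ (i, l) = (Q *\<^sub>v unit_vec n l) $ i"
        using i l by (simp add: mult_mat_vec_unit_vec[OF Q_carrier])
      also have "\<dots> = 0" using \<open>Suc l < n\<close> i by (simp add: Q_mult_unit_vec)
      finally show ?thesis by simp
    qed (simp add: x_last)
  qed
  finally show "(Q *\<^sub>v x) $ i = 0\<^sub>v n $ i" using i by simp
qed simp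

lemma shifted_D0_mult_vec_last:
  assumes x: "x \<in> carrier_vec n"
  shows "((D0 - s \<cdot>\<^sub>m 1\<^sub>m n) *\<^sub>v x) $ (2 * m) = (\<gamma> - s) * x $ (2 * m)"
  using x last_index_less
  by (simp add: minus_smult_one_mult_vec D0_mult_vec_last[OF x] left_diff_distrib del: index_mult_mat_vec)

(* Q kills e_j for j < 2 m, hence every vector with vanishing last coordinate, such as
   (D0 - gamma) e_(2 m); as Q commutes with D0, Q e_(2 m) is an eigenvector for gamma. *)
definition eigvec :: "nat \<Rightarrow> 'a vec" where
  "eigvec j = (if j = 2 * m then Q *\<^sub>v unit_vec n (2 * m)
     else if odd j then unit_vec n j else unit_vec n j + unit_vec n (Suc j))"

definition eigval :: "nat \<Rightarrow> 'a" where
  "eigval j = (if j = 2 * m then \<gamma> else if odd j then \<alpha> - 1 else \<alpha>)"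

lemma eigvec_carrier [simp]: "eigvec j \<in> carrier_vec n"
  unfolding eigvec_def by simp

lemma eigvec_dim [simp]: "dim_vec (eigvec j) = n"
  using eigvec_carrier[of j] by (rule carrier_vecD)

lemma eigvec_last: "eigvec (2 * m) $ (2 * m) = (\<gamma> - \<alpha>) * (\<gamma> - (\<alpha> - 1))"
  using last_index_less
  by (simp add: eigvec_def Q_mult_vec shifted_D0_mult_vec_last del: index_mult_mat_vec)

lemma eigvec_eigen:
  assumes j: "j < n"
  shows "D0 *\<^sub>v eigvec j = eigval j \<cdot>\<^sub>v eigvec j"
proof (cases "j = 2 * m")
  case True
  let ?e = "unit_vec n (2 * m)" and ?S = "D0 - \<gamma> \<cdot>\<^sub>m 1\<^sub>m n"
  have "?S *\<^sub>v (Q *\<^sub>v ?e) = Q *\<^sub>v (?S *\<^sub>v ?e)"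
    using assoc_mult_mat_vec[of ?S n n Q n ?e] assoc_mult_mat_vec[of Q n n ?S n ?e] Q_commute by simp
  also have "\<dots> = 0\<^sub>v n"
    by (rule Q_mult_vec_eq_0)
      (use last_index_less in \<open>simp_all add: shifted_D0_mult_vec_last del: index_mult_mat_vec\<close>)
  finally have diff: "D0 *\<^sub>v eigvec j - \<gamma> \<cdot>\<^sub>v eigvec j = 0\<^sub>v n"
    using True by (simp add: eigvec_def minus_smult_one_mult_vec)
  have "D0 *\<^sub>v eigvec j = \<gamma> \<cdot>\<^sub>v eigvec j"
  proof (rule eq_vecI)
    fix i assume "i < dim_vec (\<gamma> \<cdot>\<^sub>v eigvec j)"
    with arg_cong[OF diff, of "\<lambda>x. x $ i"] show "(D0 *\<^sub>v eigvec j) $ i = (\<gamma> \<cdot>\<^sub>v eigvec j) $ i"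
      by (simp del: index_mult_mat_vec)
  qed simp
  then show ?thesis using True by (simp add: eigval_def)
next
  case False
  with j n have j: "Suc j < n" by simp
  show ?thesis
  proof (cases "odd j")
    case True
    then show ?thesis using j False by (simp add: eigvec_def eigval_def D0_mult_unit_vec_odd)
  next
    case False
    then have ev: "even j" "odd (Suc j)" by simp_all
    with j n have j': "Suc (Suc j) < n" by presburger
    have "D0 *\<^sub>v (unit_vec n j + unit_vec n (Suc j)) = D0 *\<^sub>v unit_vec n j + D0 *\<^sub>v unit_vec n (Suc j)"
      by (simp add: mult_add_distrib_mat_vec[OF D0_carrier])
    also have "\<dots> = \<alpha> \<cdot>\<^sub>v (unit_vec n j + unit_vec n (Suc j))"
      unfolding D0_mult_unit_vec_even[OF ev(1) j] D0_mult_unit_vec_odd[OF ev(2) j']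
      by (intro eq_vecI) (auto simp: algebra_simps)
    finally show ?thesis using ev \<open>j \<noteq> 2 * m\<close> by (simp add: eigvec_def eigval_def)
  qed
qed

definition U :: "'a mat" where
  "U = mat n n (\<lambda>(i, j). eigvec j $ i)"

lemma U_carrier [simp]: "U \<in> carrier_mat n n"
  unfolding U_def by simp

lemma U_dim [simp]: "dim_row U = n" "dim_col U = n"
  unfolding U_def by simp_all

lemma col_U: "j < n \<Longrightarrow> col U j = eigvec j"
  unfolding U_def by (auto intro: eq_vecI)

lemma U_index: "i < n \<Longrightarrow> j < n \<Longrightarrow> U $$ (i, j) = eigvec j $ i"
  unfolding U_def by simp

(* Expanding along the last row, whose only nonzero entry is the diagonal one, leaves a lower
   unitriangular minor. *)
lemma det_U: "det U = (\<gamma> - \<alpha>) * (\<gamma> - (\<alpha> - 1))"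
proof -
  have row: "U $$ (2 * m, j) = (if j = 2 * m then (\<gamma> - \<alpha>) * (\<gamma> - (\<alpha> - 1)) else 0)" if "j < n" for j
  proof (cases "j = 2 * m")
    case True
    then show ?thesis using last_index_less by (simp add: U_index eigvec_last)
  next
    case False
    have "2 * m \<noteq> Suc j \<or> odd j" by presburger
    moreover have "Suc j < n" using False \<open>j < n\<close> n by simp
    ultimately show ?thesis using False last_index_less \<open>j < n\<close> by (auto simp: U_index eigvec_def)
  qed
  let ?U' = "mat_delete U (2 * m) (2 * m)"
  have n1: "n - 1 = 2 * m" using n by simp
  have U': "?U' \<in> carrier_mat (2 * m) (2 * m)" using mat_delete_carrier[OF U_carrier] n1 by simp
  have U'_index: "?U' $$ (i, j) = (if i = j \<or> i = Suc j \<and> even j then 1 else 0)"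
    if "i < 2 * m" "j < 2 * m" for i j
    using that n1 last_index_less by (auto simp: mat_delete_def U_index eigvec_def)
  have "det ?U' = prod_list (diag_mat ?U')"
    by (rule det_lower_triangular[OF _ U']) (simp add: U'_index)
  also have "diag_mat ?U' = map (\<lambda>_. 1) [0..<2 * m]"
    unfolding diag_mat_def using n1 by (intro map_cong) (auto simp: U'_index)
  finally have det_U': "det ?U' = 1" by (simp add: map_replicate_const)
  have "det U = (\<Sum>j<n. U $$ (2 * m, j) * cofactor U (2 * m) j)"
    by (rule laplace_expansion_row[OF U_carrier last_index_less])
  also have "\<dots> = (\<gamma> - \<alpha>) * (\<gamma> - (\<alpha> - 1)) * cofactor U (2 * m) (2 * m)"
    using last_index_less by (simp add: row if_distrib[of "\<lambda>x. x * _"] cong: if_cong)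
  also have "cofactor U (2 * m) (2 * m) = 1" by (simp add: cofactor_def det_U')
  finally show ?thesis by simp
qed

lemma square_zero_plus_diagonalizable: "square_zero_plus_diagonalizable M {\<gamma>, \<alpha>, \<alpha> - 1}"
proof -
  have "det U \<noteq> 0" using \<gamma>_\<alpha> \<gamma>_\<beta> by (simp add: det_U)
  then have sim: "similar_mat D0 (mat_diag n eigval)"
    by (intro eigenbasis_similar_mat_diag[OF D0_carrier U_carrier]) (simp_all add: col_U eigvec_eigen)
  have "M = N0 + D0" unfolding D0_def by (intro eq_matI) auto
  moreover have "diagonalizable D0" by (rule diagonalizable_similar[OF sim diagonalizable_mat_diag])
  moreover have "e \<in> {\<gamma>, \<alpha>, \<alpha> - 1}" if "eigenvalue D0 e" for e
  proof -
    from that have "eigenvalue (mat_diag n eigval) e" using eigenvalue_similar[OF sim] by simp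
    then obtain j where "e = eigval j" using eigenvalue_mat_diag by blast
    then show ?thesis by (simp add: eigval_def)
  qed
  ultimately show ?thesis
    unfolding square_zero_plus_diagonalizable_def M_dim using N0_square N0_carrier D0_carrier by blast
qed

end

lemma sum_alternating: "(\<Sum>j<2 * m. if even j then x else y) = of_nat m * (x + y)"
  by (induct m) (simp_all add: algebra_simps)

lemma diff_one_eq_add_one:
  assumes "(2 :: 'a :: ring_1) = 0"
  shows "x - 1 = x + (1 :: 'a)"
proof -
  have "(1 :: 'a) = - 1" using assms by (simp add: eq_neg_iff_add_eq_0)
  then show ?thesis by (metis diff_minus_eq_add)
qed

theorem proposition2p9:
  fixes B :: "'a :: field mat" and k :: nat and c :: 'a
  assumes "CHAR('a) = 2"
    and "infinite (UNIV :: 'a set) \<or> card (UNIV :: 'a set) \<ge> 4"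
    and "k \<ge> 1"
    and "B \<in> carrier_mat (4 * k + 1) (4 * k + 1)"
    and "non_derogative B"
    and "mat_trace B = c"
  shows "\<forall>a :: 'a. a \<noteq> 0 \<and> a \<noteq> 1 \<longrightarrow>
    (\<exists>N D. N \<in> carrier_mat (4 * k + 1) (4 * k + 1) \<and>
           D \<in> carrier_mat (4 * k + 1) (4 * k + 1) \<and>
           B = N + D \<and> N * N = 0\<^sub>m (4 * k + 1) (4 * k + 1) \<and>
           diagonalizable D \<and>
           (\<forall>e. eigenvalue D e \<longrightarrow> e \<in> {c, c + 1, c + a, c + a + 1}))"
proof -
  \<comment> \<open>The size of the field only guarantees that such an a exists, and k = 0 would do as well.\<close>
  let ?n = "Suc (2 * (2 * k))"
  have n: "4 * k + 1 = ?n" by simp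
  have two: "(2 :: 'a) = 0" using of_nat_CHAR[where 'a = 'a] assms(1) by simp
  obtain v where v: "v \<in> carrier_vec ?n" "is_cyclic_vector B v"
    using non_derogative_cyclic_vector[OF assms(4,5)[unfolded n]] .
  have "square_zero_plus_diagonalizable B {c, c + 1, c + a, c + a + 1}" if a: "a \<noteq> 0" "a \<noteq> 1" for a
  proof -
    let ?\<mu> = "\<lambda>j. if even j then c + a else c + a - 1"
    interpret newton_basis B ?n v ?\<mu> using assms(4) v by unfold_locales simp_all
    obtain M where sim: "similar_mat B M" and M: "newton_form ?n ?\<mu> M"
      using similar_newton_form by blast
    have "(\<Sum>j<2 * (2 * k). ?\<mu> j) = of_nat (2 * k) * (c + a + (c + a - 1))"
      by (rule sum_alternating)
    also have "\<dots> = 0" using two by simp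
    finally have "M $$ (2 * (2 * k), 2 * (2 * k)) = c"
      using mat_trace_similar[OF sim] newton_form_trace[OF M] assms(6) by simp
    with M a interpret alternating_newton_form M ?n "2 * k" "c + a" c
      by unfold_locales simp_all
    have "square_zero_plus_diagonalizable B {c, c + a, c + a - 1}"
      by (rule square_zero_plus_diagonalizable_similar[OF sim square_zero_plus_diagonalizable])
    moreover have "{c, c + a, c + a - 1} \<subseteq> {c, c + 1, c + a, c + a + 1}"
      using diff_one_eq_add_one[OF two] by auto
    ultimately show ?thesis by (rule square_zero_plus_diagonalizable_mono)
  qed
  then show ?thesis using assms(4) unfolding square_zero_plus_diagonalizable_def by simp
qed

end
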